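(* The principle $\mathbf{P}$: $A \rhd B \to \Box(A \rhd B)$ is valid in all simplified $\mathbf{IL}^-(\mathbf{P})$-frames (for all $\mathcal{L}(\rhd)$-formulas $A$ and $B$).
   Context: The language $\mathcal{L}(\rhd)$ has countably many propositional variables, the constant $\bot$, connectives $\neg, \land, \lor, \to$, a unary modal operator $\Box$ and a binary modal operator $\rhd$. A simplified $\mathbf{IL}^-(\mathbf{P})$-frame is a triple $(W, R, S)$ where $W$ is a non-empty set, $R$ is a transitive and conversely well-founded binary relation on $W$, and $S$ is an arbitrary binary relation on $W$. A simplified $\mathbf{IL}^-(\mathbf{P})$-model is a quadruple $(W,R,S,\Vdash)$ where $(W,R,S)$ is such a frame and $\Vdash$ is a relation between $W$ and $\mathcal{L}(\rhd)$-formulas satisfying the usual Boolean clauses, $w \Vdash \Box A \iff (\forall x \in W)(w R x \Rightarrow x \Vdash A)$, and $w \Vdash A \rhd B \iff (\forall x \in W)\bigl(w R x \ \&\ x \Vdash A \Rightarrow (\exists y \in W)(x S y \ \&\ y \Vdash B)\bigr)$. A formula is valid in a frame if it is satisfied at every $w \in W$ in every model based on the frame. *)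

theory Defs
  imports Main
begin

datatype fm =
    Var nat
  | Bot  ("\<^bold>\<bottom>")
  | Neg fm  ("\<^bold>\<not> _" [60] 60)
  | Conj fm fm  (infixr "\<^bold>\<and>" 55)
  | Disj fm fm  (infixr "\<^bold>\<or>" 54)
  | Imp fm fm  (infixr "\<^bold>\<rightarrow>" 52)
  | Box fm  ("\<^bold>\<box> _" [60] 60)
  | Rhd fm fm  (infix "\<^bold>\<rhd>" 53)

definition simplified_ILP_frame :: "'w set \<Rightarrow> 'w rel \<Rightarrow> 'w rel \<Rightarrow> bool" where
  "simplified_ILP_frame W R S \<longleftrightarrow>
     W \<noteq> {} \<and> R \<subseteq> W \<times> W \<and> S \<subseteq> W \<times> W \<and> trans R \<and> wf (R\<inverse>)"

definition simplified_ILP_model ::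
  "'w set \<Rightarrow> 'w rel \<Rightarrow> 'w rel \<Rightarrow> ('w \<times> fm) set \<Rightarrow> bool" where
  "simplified_ILP_model W R S F \<longleftrightarrow>
     simplified_ILP_frame W R S \<and> F \<subseteq> W \<times> UNIV \<and>
     (\<forall>w\<in>W. \<forall>A B.
        (w, \<^bold>\<bottom>) \<notin> F \<and>
        ((w, \<^bold>\<not> A) \<in> F \<longleftrightarrow> (w, A) \<notin> F) \<and>
        ((w, A \<^bold>\<and> B) \<in> F \<longleftrightarrow> (w, A) \<in> F \<and> (w, B) \<in> F) \<and>
        ((w, A \<^bold>\<or> B) \<in> F \<longleftrightarrow> (w, A) \<in> F \<or> (w, B) \<in> F) \<and>
        ((w, A \<^bold>\<rightarrow> B) \<in> F \<longleftrightarrow> ((w, A) \<in> F \<longrightarrow> (w, B) \<in> F)) \<and>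
        ((w, \<^bold>\<box> A) \<in> F \<longleftrightarrow> (\<forall>x\<in>W. (w, x) \<in> R \<longrightarrow> (x, A) \<in> F)) \<and>
        ((w, A \<^bold>\<rhd> B) \<in> F \<longleftrightarrow>
           (\<forall>x\<in>W. (w, x) \<in> R \<and> (x, A) \<in> F \<longrightarrow> (\<exists>y\<in>W. (x, y) \<in> S \<and> (y, B) \<in> F))))"

definition valid_in_frame :: "'w set \<Rightarrow> 'w rel \<Rightarrow> 'w rel \<Rightarrow> fm \<Rightarrow> bool" where
  "valid_in_frame W R S A \<longleftrightarrow>
     (\<forall>F. simplified_ILP_model W R S F \<longrightarrow> (\<forall>w\<in>W. (w, A) \<in> F))"

end

theory Submission
  imports Defs
begin

text \<open>Here \<open>S\<close> is one relation shared by all worlds, so whether a world \<open>x\<close> satisfying \<open>A\<close>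
  has an \<open>S\<close>-successor satisfying \<open>B\<close> does not depend on the world from which \<open>x\<close> is seen.
  Thus the truth of \<open>A \<^bold>\<rhd> B\<close> at \<open>w\<close> is a universal statement about the \<open>R\<close>-successors of \<open>w\<close>,
  and by transitivity of \<open>R\<close> it is inherited by each of those successors.\<close>

theorem proposition4p5:
  fixes W :: "'w set" and R S :: "'w rel" and A B :: fm
  assumes "simplified_ILP_frame W R S"
  shows "valid_in_frame W R S ((A \<^bold>\<rhd> B) \<^bold>\<rightarrow> \<^bold>\<box> (A \<^bold>\<rhd> B))"
  unfolding valid_in_frame_def
proof (intro allI impI ballI)
  fix F w
  assume model: "simplified_ILP_model W R S F" and w: "w \<in> W"
  have R_trans: "trans R"
    using assms by (simp add: simplified_ILP_frame_def)
  have imp: "(u, C \<^bold>\<rightarrow> D) \<in> F \<longleftrightarrow> ((u, C) \<in> F \<longrightarrow> (u, D) \<in> F)"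
    and box: "(u, \<^bold>\<box> C) \<in> F \<longleftrightarrow> (\<forall>x\<in>W. (u, x) \<in> R \<longrightarrow> (x, C) \<in> F)"
    and rhd: "(u, C \<^bold>\<rhd> D) \<in> F \<longleftrightarrow>
      (\<forall>x\<in>W. (u, x) \<in> R \<and> (x, C) \<in> F \<longrightarrow> (\<exists>y\<in>W. (x, y) \<in> S \<and> (y, D) \<in> F))"
    if "u \<in> W" for u C D
    using model that unfolding simplified_ILP_model_def by simp_all
  have "(v, A \<^bold>\<rhd> B) \<in> F" if wAB: "(w, A \<^bold>\<rhd> B) \<in> F" and v: "v \<in> W" "(w, v) \<in> R" for v
    unfolding rhd[OF v(1)]
  proof (intro ballI impI, elim conjE)
    fix x
    assume x: "x \<in> W" "(v, x) \<in> R" "(x, A) \<in> F"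
    have "(w, x) \<in> R"
      using R_trans v(2) x(2) by (rule transD)
    then show "\<exists>y\<in>W. (x, y) \<in> S \<and> (y, B) \<in> F"
      using wAB x unfolding rhd[OF w] by blast
  qed
  then show "(w, (A \<^bold>\<rhd> B) \<^bold>\<rightarrow> \<^bold>\<box> (A \<^bold>\<rhd> B)) \<in> F"
    unfolding imp[OF w] box[OF w] by blast
qed

end
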